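(* Let $S\ge1$ and, for each $s\in[S]=\{1,\dots,S\}$, let $R_s:\mathbb R^d\to\mathbb R^{m_s}$ be a $C^2$ definable map. Let $f_{\mathrm{GDRO}}(x)=\max_{s\in[S]}\tfrac12\|R_s(x)\|^2$. Let $\bar x$ be a common interpolator, i.e. $R_s(\bar x)=0$ for every $s\in[S]$. For $s\in[S]$ let $q_s(v)=\tfrac12\|DR_s(\bar x)[v]\|^2$, $v\in\mathbb R^d$, and for a linear subspace $\mathcal W\subseteq\mathbb R^d$ let $$\mathcal D_s(\mathcal W)=\{v\in\mathcal W\setminus\{0\}: q_s(v)>q_j(v)\text{ for every }j\ne s\}.$$ Suppose there are a linear subspace $\mathcal W\subseteq\mathbb R^d$ and distinct indices $s_1,s_2\in[S]$ such that both $\mathcal D_{s_1}(\mathcal W)$ and $\mathcal D_{s_2}(\mathcal W)$ are nonempty. Then $\bar x$ is an inactive global minimizer of $f_{\mathrm{GDRO}}$.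
   Context: "Definable" means definable in a fixed o-minimal structure on the real field. $\partial$ denotes the limiting subdifferential. For a locally Lipschitz $h:\mathbb R^d\to\mathbb R$ and $\bar v\in\partial h(\bar x)$, a set $\mathcal M\ni\bar x$ is identifiable for $h$ at $\bar x$ for $\bar v$ if for all sequences $x_\nu\to\bar x$, $v_\nu\to\bar v$ with $v_\nu\in\partial h(x_\nu)$ one has $x_\nu\in\mathcal M$ for all large $\nu$. It is a $C^2$ identifiable manifold if it is identifiable and, in a neighborhood of $\bar x$, is a $C^2$ embedded submanifold of $\mathbb R^d$ on which $h$ restricts to a $C^2$ function. A point $\bar x$ with $0\in\partial h(\bar x)$ is inactive if no $C^2$ identifiable manifold exists for $h$ at $\bar x$ for $0$. *)

theory Defs
  imports "HOL-Analysis.Analysis"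
begin

text \<open>The space R^n is rendered as the set of real lists of length n, so that n can vary.\<close>

locale o_minimal_structure =
  fixes Dfn :: "nat \<Rightarrow> real list set set"
  assumes dim: "A \<in> Dfn n \<Longrightarrow> A \<subseteq> {xs. length xs = n}"
    and empty: "{} \<in> Dfn n"
    and union: "A \<in> Dfn n \<Longrightarrow> B \<in> Dfn n \<Longrightarrow> A \<union> B \<in> Dfn n"
    and complement: "A \<in> Dfn n \<Longrightarrow> {xs. length xs = n} - A \<in> Dfn n"
    and product_right: "A \<in> Dfn n \<Longrightarrow> {xs @ [t] | xs t. xs \<in> A} \<in> Dfn (Suc n)"
    and product_left: "A \<in> Dfn n \<Longrightarrow> {t # xs | xs t. xs \<in> A} \<in> Dfn (Suc n)"
    and diagonal: "i < j \<Longrightarrow> j < n \<Longrightarrow> {xs. length xs = n \<and> xs ! i = xs ! j} \<in> Dfn n"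
    and projection: "A \<in> Dfn (Suc n) \<Longrightarrow> butlast ` A \<in> Dfn n"
    and order: "{[x, y] | x y. x < y} \<in> Dfn 2"
    and addition: "{[x, y, x + y] | x y. True} \<in> Dfn 3"
    and multiplication: "{[x, y, x * y] | x y. True} \<in> Dfn 3"
    \<comment> \<open>\<open>is_interval\<close> covers points and bounded or unbounded intervals of every kind.\<close>
    and o_minimality: "(\<lambda>t. [t]) ` E \<in> Dfn 1 \<longleftrightarrow>
          (\<exists>F. finite F \<and> (\<forall>I\<in>F. is_interval I) \<and> E = \<Union>F)"

text \<open>The index type carries no order; \<open>from_nat_into UNIV\<close> is the library's fixed
  bijection from \<open>{..<CARD('d)}\<close> onto it. Definability does not depend on this choice,
  because the definable sets are closed under permuting coordinates.\<close>

definition coords :: "real ^ 'd \<Rightarrow> real list" where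
  "coords x = map (\<lambda>i. x $ from_nat_into UNIV i) [0..<CARD('d)]"

text \<open>A map into R^m is given by its components \<open>F x i\<close> with \<open>i < m\<close>; values at \<open>i \<ge> m\<close>
  are irrelevant. This allows the target dimension to depend on a parameter.\<close>

definition definable_map ::
    "(nat \<Rightarrow> real list set set) \<Rightarrow> nat \<Rightarrow> (real ^ 'd \<Rightarrow> nat \<Rightarrow> real) \<Rightarrow> bool" where
  "definable_map Dfn m F \<longleftrightarrow>
     {coords x @ map (F x) [0..<m] | x. True} \<in> Dfn (CARD('d) + m)"

definition C2_on :: "'a::real_normed_vector set \<Rightarrow> ('a \<Rightarrow> 'b::real_normed_vector) \<Rightarrow> bool" where
  "C2_on U f \<longleftrightarrow> open U \<and>
     (\<exists>(f' :: 'a \<Rightarrow> 'a \<Rightarrow>\<^sub>L 'b) (f'' :: 'a \<Rightarrow> 'a \<Rightarrow>\<^sub>L 'a \<Rightarrow>\<^sub>L 'b).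
        (\<forall>x\<in>U. (f has_derivative blinfun_apply (f' x)) (at x)) \<and>
        (\<forall>x\<in>U. (f' has_derivative blinfun_apply (f'' x)) (at x)) \<and>
        continuous_on U f'')"

definition C2_map :: "nat \<Rightarrow> (real ^ 'd \<Rightarrow> nat \<Rightarrow> real) \<Rightarrow> bool" where
  "C2_map m F \<longleftrightarrow> (\<forall>i<m. C2_on UNIV (\<lambda>x. F x i))"

text \<open>Local straightening: \<open>\<phi>\<close> is a diffeomorphism of \<open>U\<close> onto the open set \<open>\<phi> ` U\<close>, with
  inverse \<open>\<psi>\<close>, taking \<open>N\<close> to a linear subspace of dimension k.\<close>

definition C2_embedded_submanifold :: "'a::euclidean_space set \<Rightarrow> bool" where
  "C2_embedded_submanifold N \<longleftrightarrow>
     (\<exists>k. \<forall>p\<in>N. \<exists>U (\<phi> :: 'a \<Rightarrow> 'a) (\<psi> :: 'a \<Rightarrow> 'a) L.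
        p \<in> U \<and> C2_on U \<phi> \<and> C2_on (\<phi> ` U) \<psi> \<and> (\<forall>x\<in>U. \<psi> (\<phi> x) = x) \<and>
        subspace L \<and> dim L = k \<and> \<phi> ` (N \<inter> U) = \<phi> ` U \<inter> L)"

definition restricts_C2 :: "'a::euclidean_space set \<Rightarrow> ('a \<Rightarrow> real) \<Rightarrow> bool" where
  "restricts_C2 N h \<longleftrightarrow>
     (\<forall>p\<in>N. \<exists>U g. p \<in> U \<and> C2_on U g \<and> (\<forall>x\<in>N \<inter> U. g x = h x))"

definition regular_subdifferential :: "('a::real_inner \<Rightarrow> real) \<Rightarrow> 'a \<Rightarrow> 'a set" where
  "regular_subdifferential h x =
     {v. \<forall>\<epsilon>>0. \<forall>\<^sub>F y in at x. h y \<ge> h x + v \<bullet> (y - x) - \<epsilon> * norm (y - x)}"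

definition limiting_subdifferential :: "('a::real_inner \<Rightarrow> real) \<Rightarrow> 'a \<Rightarrow> 'a set" where
  "limiting_subdifferential h x =
     {v. \<exists>X V. X \<longlonglongrightarrow> x \<and> (\<lambda>n. h (X n)) \<longlonglongrightarrow> h x \<and>
           (\<forall>n. V n \<in> regular_subdifferential h (X n)) \<and> V \<longlonglongrightarrow> v}"

definition identifiable ::
    "('a::real_inner \<Rightarrow> real) \<Rightarrow> 'a \<Rightarrow> 'a \<Rightarrow> 'a set \<Rightarrow> bool" where
  "identifiable h xbar vbar M \<longleftrightarrow> xbar \<in> M \<and>
     (\<forall>X V. X \<longlonglongrightarrow> xbar \<longrightarrow> V \<longlonglongrightarrow> vbar \<longrightarrow>
        (\<forall>n. V n \<in> limiting_subdifferential h (X n)) \<longrightarrow>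
        (\<forall>\<^sub>F n in sequentially. X n \<in> M))"

definition C2_identifiable_manifold ::
    "('a::euclidean_space \<Rightarrow> real) \<Rightarrow> 'a \<Rightarrow> 'a \<Rightarrow> 'a set \<Rightarrow> bool" where
  "C2_identifiable_manifold h xbar vbar M \<longleftrightarrow> identifiable h xbar vbar M \<and>
     (\<exists>U. open U \<and> xbar \<in> U \<and> C2_embedded_submanifold (M \<inter> U) \<and> restricts_C2 (M \<inter> U) h)"

definition inactive :: "('a::euclidean_space \<Rightarrow> real) \<Rightarrow> 'a \<Rightarrow> bool" where
  "inactive h xbar \<longleftrightarrow> 0 \<in> limiting_subdifferential h xbar \<and>
     (\<nexists>M. C2_identifiable_manifold h xbar 0 M)"

definition f_GDRO ::
    "nat \<Rightarrow> (nat \<Rightarrow> nat) \<Rightarrow> (nat \<Rightarrow> 'a \<Rightarrow> nat \<Rightarrow> real) \<Rightarrow> 'a \<Rightarrow> real" where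
  "f_GDRO S m R x = (MAX s\<in>{1..S}. 1/2 * (\<Sum>i<m s. (R s x i)\<^sup>2))"

definition q_form ::
    "(nat \<Rightarrow> nat) \<Rightarrow> (nat \<Rightarrow> 'a::real_normed_vector \<Rightarrow> nat \<Rightarrow> real) \<Rightarrow> 'a \<Rightarrow> nat \<Rightarrow> 'a \<Rightarrow> real" where
  "q_form m R xbar s v =
     1/2 * (\<Sum>i<m s. (frechet_derivative (\<lambda>x. R s x i) (at xbar) v)\<^sup>2)"

definition dominance_set ::
    "nat \<Rightarrow> (nat \<Rightarrow> nat) \<Rightarrow> (nat \<Rightarrow> 'a::real_normed_vector \<Rightarrow> nat \<Rightarrow> real) \<Rightarrow> 'a
      \<Rightarrow> 'a set \<Rightarrow> nat \<Rightarrow> 'a set" where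
  "dominance_set S m R xbar W s =
     {v \<in> W - {0}. \<forall>j\<in>{1..S}. j \<noteq> s \<longrightarrow> q_form m R xbar s v > q_form m R xbar j v}"

end

theory Submission
  imports Defs
begin

text \<open>
  At a common interpolator every piece \<open>f\<^sub>s = 1/2 \<parallel>R\<^sub>s\<parallel>\<^sup>2\<close> vanishes together with its gradient, and its
  second derivative \<open>H\<^sub>s\<close> is given by \<open>H\<^sub>s(v, v) = 2 q\<^sub>s(v)\<close>. Since the maximum is nonnegative and
  zero at \<open>xbar\<close>, the point is a global minimizer, and \<open>0\<close> is a subgradient there. The real
  content is that no \<open>C\<^sup>2\<close> identifiable manifold can exist.

  Let \<open>D\<^sub>s\<close> be the set of all directions \<open>v\<close> with \<open>q\<^sub>s(v) > q\<^sub>j(v)\<close> for every \<open>j \<noteq> s\<close>. These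
  sets are open in the whole space, and by the dominance hypotheses they are nonempty for \<open>s1\<close>
  and \<open>s2\<close>. For \<open>v\<close> in \<open>D\<^sub>s\<close> and small \<open>t > 0\<close> the piece
  \<open>f\<^sub>s\<close> is strictly the largest at \<open>xbar + t v\<close>, so there the maximum is differentiable with the
  gradient of \<open>f\<^sub>s\<close>. These gradients tend to \<open>0\<close> as \<open>t\<close> does, so an identifiable set \<open>M\<close>
  contains \<open>xbar + t v\<close> for all small \<open>t > 0\<close>
  (\<open>identifiable_captures_ray_of_smooth_piece\<close>).

  If \<open>M\<close> is a manifold near \<open>xbar\<close>, its tangent space therefore contains an open set of
  directions, hence is everything, and \<open>M\<close> is a neighbourhood of \<open>xbar\<close>
  (\<open>submanifold_with_open_tangent_cone\<close>). Then the maximum is itself \<open>C\<^sup>2\<close> near \<open>xbar\<close>. Its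
  gradient agrees with that of \<open>f\<^sub>s\<close> along every ray with direction in \<open>D\<^sub>s\<close>, so its second
  derivative agrees with \<open>H\<^sub>s\<close> on the open set \<open>D\<^sub>s\<close>, hence everywhere by linearity. Applied to
  \<open>s1\<close> and \<open>s2\<close>, this makes the two second derivatives equal, although \<open>q\<close> of \<open>s1\<close> is strictly
  larger than \<open>q\<close> of \<open>s2\<close> at a direction that \<open>s1\<close> dominates
  (\<open>no_C2_identifiable_manifold_of_two_dominating_pieces\<close>).
\<close>

section \<open>Derivatives along rays\<close>

lemma ray_tendsto:
  fixes p v :: "'a::real_normed_vector"
  shows "((\<lambda>t. p + t *\<^sub>R v) \<longlongrightarrow> p) (at_right 0)"
proof -
  have "((\<lambda>t. p + t *\<^sub>R v) \<longlongrightarrow> p + 0 *\<^sub>R v) (at_right 0)"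
    by (intro tendsto_intros)
  then show ?thesis by simp
qed

lemma ray_eventually_in_open:
  fixes p v :: "'a::real_normed_vector"
  assumes "open U" "p \<in> U"
  shows "\<forall>\<^sub>F t in at_right 0. p + t *\<^sub>R v \<in> U"
  using topological_tendstoD[OF ray_tendsto assms] .

text \<open>Limits along rays are taken as \<open>t\<close> tends to \<open>0\<close> from the right only, since dominance of one
  piece will be known only for small positive \<open>t\<close>; one side already determines the derivative.\<close>

lemma ray_difference_quotient:
  assumes "(f has_derivative f') (at p)"
  shows "((\<lambda>t. (f (p + t *\<^sub>R v) - f p) /\<^sub>R t) \<longlongrightarrow> f' v) (at_right 0)"
proof -
  interpret f': bounded_linear f'
    using assms by (rule has_derivative_bounded_linear)
  have "((\<lambda>t. p + t *\<^sub>R v) has_derivative (\<lambda>t. t *\<^sub>R v)) (at 0)"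
    by (auto intro!: derivative_eq_intros)
  from has_derivative_compose[OF this, of f f'] assms
  have "((\<lambda>t. f (p + t *\<^sub>R v)) has_derivative (\<lambda>t. f' (t *\<^sub>R v))) (at 0)"
    by simp
  then have "((\<lambda>t. f (p + t *\<^sub>R v)) has_derivative (\<lambda>t. f' (t *\<^sub>R v))) (at_right 0)"
    by (rule has_derivative_at_withinI)
  then have "((\<lambda>t. (f (p + t *\<^sub>R v) - f p - t *\<^sub>R f' v) /\<^sub>R \<bar>t\<bar>) \<longlongrightarrow> 0) (at_right 0)"
    by (simp add: has_derivative_at_within f'.scaleR)
  from tendsto_add[OF this tendsto_const[of "f' v"]]
  have "((\<lambda>t. (f (p + t *\<^sub>R v) - f p - t *\<^sub>R f' v) /\<^sub>R \<bar>t\<bar> + f' v) \<longlongrightarrow> f' v) (at_right 0)"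
    by simp
  then show ?thesis
  proof (rule Lim_transform_eventually)
    show "\<forall>\<^sub>F t in at_right 0. (f (p + t *\<^sub>R v) - f p - t *\<^sub>R f' v) /\<^sub>R \<bar>t\<bar> + f' v
        = (f (p + t *\<^sub>R v) - f p) /\<^sub>R t"
      using eventually_at_right_less[of 0]
      by eventually_elim (simp add: scaleR_diff_right)
  qed
qed

text \<open>The difference quotients lie in the subspace, which is closed in finite dimension.\<close>

lemma derivative_along_ray_in_subspace:
  fixes \<phi> :: "'a::real_normed_vector \<Rightarrow> 'b::euclidean_space"
  assumes "(\<phi> has_derivative \<phi>') (at p)" "subspace L" "\<phi> p \<in> L"
    and "\<forall>\<^sub>F t in at_right 0. \<phi> (p + t *\<^sub>R v) \<in> L"
  shows "\<phi>' v \<in> L"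
proof (rule Lim_in_closed_set[OF _ _ _ ray_difference_quotient[OF assms(1)]])
  show "closed L" using assms(2) by (rule closed_subspace)
  show "\<forall>\<^sub>F t in at_right 0. (\<phi> (p + t *\<^sub>R v) - \<phi> p) /\<^sub>R t \<in> L"
    using assms(4) by eventually_elim (simp add: assms subspace_diff subspace_scale)
qed simp

text \<open>Continuity forces \<open>G p = K p\<close>, so that the difference quotients of \<open>G\<close> and \<open>K\<close> along the ray
  eventually coincide. Applied to gradients, this compares second derivatives without any
  Taylor expansion.\<close>

lemma derivatives_agree_along_ray:
  fixes G K :: "'a::real_normed_vector \<Rightarrow> 'b::real_normed_vector"
  assumes "(G has_derivative G') (at p)" "(K has_derivative K') (at p)"
    and eq: "\<forall>\<^sub>F t in at_right 0. G (p + t *\<^sub>R v) = K (p + t *\<^sub>R v)"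
  shows "G' v = K' v"
proof -
  have d: "((\<lambda>x. G x - K x) has_derivative (\<lambda>x. G' x - K' x)) (at p)"
    using assms by (intro derivative_intros)
  have "((\<lambda>t. G (p + t *\<^sub>R v) - K (p + t *\<^sub>R v)) \<longlongrightarrow> G p - K p) (at_right 0)"
    using isCont_tendsto_compose[OF has_derivative_continuous[OF d] ray_tendsto] .
  moreover have "((\<lambda>t. G (p + t *\<^sub>R v) - K (p + t *\<^sub>R v)) \<longlongrightarrow> 0) (at_right 0)"
    by (rule tendsto_eventually) (use eq in \<open>eventually_elim, simp\<close>)
  ultimately have "G p - K p = 0"
    using tendsto_unique trivial_limit_at_right_real by blast
  then have "((\<lambda>t. (G (p + t *\<^sub>R v) - K (p + t *\<^sub>R v) - (G p - K p)) /\<^sub>R t) \<longlongrightarrow> 0) (at_right 0)"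
    by (intro tendsto_eventually) (use eq in \<open>eventually_elim, simp\<close>)
  with ray_difference_quotient[OF d, of v] have "G' v - K' v = 0"
    using tendsto_unique trivial_limit_at_right_real by blast
  then show ?thesis by simp
qed

text \<open>A nonempty open set spans: \<open>w\<close> is a multiple of the difference of \<open>v + t w\<close> and \<open>v\<close>, which both lie in
  \<open>D\<close> for small \<open>t\<close>. With \<open>L = {0}\<close> this says that a linear map is determined by its values on a
  nonempty open set.\<close>

lemma linear_image_of_open_in_subspace:
  fixes f :: "'a::real_normed_vector \<Rightarrow> 'b::real_vector"
  assumes "linear f" "subspace L" "open D" "v \<in> D" "\<And>u. u \<in> D \<Longrightarrow> f u \<in> L"
  shows "f w \<in> L"
proof -
  have "\<forall>\<^sub>F t in at_right 0. v + t *\<^sub>R w \<in> D \<and> (0::real) < t"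
    using ray_eventually_in_open[OF assms(3,4)] eventually_at_right_less
    by (rule eventually_conj)
  then obtain t :: real where t: "v + t *\<^sub>R w \<in> D" "0 < t"
    using eventually_happens trivial_limit_at_right_real by blast
  have "f (v + t *\<^sub>R w) - f v \<in> L"
    using assms t by (simp add: subspace_diff)
  then have "t *\<^sub>R f w \<in> L"
    using assms(1) by (simp add: linear_add linear_scale)
  then have "inverse t *\<^sub>R (t *\<^sub>R f w) \<in> L"
    using assms(2) subspace_scale by blast
  then show ?thesis using t by simp
qed

section \<open>Subgradients and identifiable sets\<close>

lemma gradient_regular_subgradient:
  assumes "(h has_derivative (\<lambda>y. g \<bullet> y)) (at x)"
  shows "g \<in> regular_subdifferential h x"
proof -
  have lim: "((\<lambda>y. norm (h y - h x - g \<bullet> (y - x)) / norm (y - x)) \<longlongrightarrow> 0) (at x)"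
    using assms by (simp add: has_derivative_iff_norm)
  have "\<forall>\<^sub>F y in at x. h y \<ge> h x + g \<bullet> (y - x) - e * norm (y - x)" if "e > 0" for e
    using order_tendstoD(2)[OF lim that] eventually_neq_at_within[of x x UNIV]
  proof eventually_elim
    case (elim y)
    then have "\<bar>h y - h x - g \<bullet> (y - x)\<bar> < e * norm (y - x)"
      by (simp add: divide_less_eq)
    then show ?case by linarith
  qed
  then show ?thesis by (simp add: regular_subdifferential_def)
qed

lemma regular_subgradient_limiting:
  assumes "v \<in> regular_subdifferential h x"
  shows "v \<in> limiting_subdifferential h x"
  unfolding limiting_subdifferential_def mem_Collect_eq
  by (rule exI[of _ "\<lambda>_. x"], rule exI[of _ "\<lambda>_. v"]) (simp add: assms)

lemma zero_limiting_subgradient_of_global_minimizer: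
  assumes "\<And>y. h x \<le> h y"
  shows "0 \<in> limiting_subdifferential h x"
proof (rule regular_subgradient_limiting)
  have "h x - e * norm (y - x) \<le> h y" if "e > 0" for e y
    using assms[of y] that by (smt (verit) mult_nonneg_nonneg norm_ge_zero)
  then show "0 \<in> regular_subdifferential h x"
    by (simp add: regular_subdifferential_def)
qed

text \<open>Identifiability speaks of sequences whose subgradient condition holds at every index, whereas
  along a curve it holds only for small \<open>t\<close>. Restricting to sequences of parameters below a
  threshold \<open>b\<close> reconciles the two.\<close>

lemma identifiable_captures_curve:
  assumes M: "identifiable h p u M"
    and X: "(X \<longlongrightarrow> p) (at_right (0::real))" and V: "(V \<longlongrightarrow> u) (at_right 0)"
    and sub: "\<forall>\<^sub>F t in at_right 0. V t \<in> limiting_subdifferential h (X t)"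
  shows "\<forall>\<^sub>F t in at_right 0. X t \<in> M"
proof -
  obtain b where b: "b > 0" "\<And>t. 0 < t \<Longrightarrow> t < b \<Longrightarrow> V t \<in> limiting_subdifferential h (X t)"
    using sub by (auto simp: eventually_at_right_field)
  show ?thesis
  proof (rule sequentially_imp_eventually_at_right[OF b(1)])
    fix t :: "nat \<Rightarrow> real"
    assume t: "\<And>n. 0 < t n" "\<And>n. t n < b" "t \<longlonglongrightarrow> 0"
    then have lim: "filterlim t (at_right 0) sequentially"
      by (auto simp: filterlim_at less_imp_neq[symmetric])
    show "\<forall>\<^sub>F n in sequentially. X (t n) \<in> M"
      using M filterlim_compose[OF X lim] filterlim_compose[OF V lim] b(2) t(1,2)
      unfolding identifiable_def by blast
  qed
qed

text \<open>The Riesz representative of a functional. Subgradients are vectors, while derivatives are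
  functionals.\<close>

definition gradient_vector :: "('a::euclidean_space \<Rightarrow>\<^sub>L real) \<Rightarrow> 'a" where
  "gradient_vector A = (\<Sum>b\<in>Basis. A b *\<^sub>R b)"

lemma gradient_vector_inner: "gradient_vector A \<bullet> y = A y"
proof -
  have "A y = A (\<Sum>b\<in>Basis. (y \<bullet> b) *\<^sub>R b)"
    by (simp add: euclidean_representation)
  also have "\<dots> = gradient_vector A \<bullet> y"
    by (simp add: gradient_vector_def blinfun.sum_right blinfun.scaleR_right
        inner_sum_left inner_commute[of y] mult.commute)
  finally show ?thesis by simp
qed

text \<open>The function \<open>h\<close> may have a kink at \<open>p\<close>; \<open>G\<close> stands for the derivative of the smooth piece
  with which \<open>h\<close> coincides around the points of the ray. Continuity of \<open>G\<close> at the critical point \<open>p\<close> makes the gradients of \<open>h\<close> along the ray converge to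
  the distinguished subgradient \<open>0\<close>.\<close>

lemma identifiable_captures_ray_of_smooth_piece:
  fixes h :: "'a::euclidean_space \<Rightarrow> real" and G :: "'a \<Rightarrow> 'a \<Rightarrow>\<^sub>L real"
  assumes M: "identifiable h p 0 M"
    and G: "isCont G p" "G p = 0"
    and h: "\<forall>\<^sub>F t in at_right 0. (h has_derivative G (p + t *\<^sub>R v)) (at (p + t *\<^sub>R v))"
  shows "\<forall>\<^sub>F t in at_right 0. p + t *\<^sub>R v \<in> M"
proof (rule identifiable_captures_curve[OF M ray_tendsto])
  have "((\<lambda>t. G (p + t *\<^sub>R v)) \<longlongrightarrow> 0) (at_right 0)"
    using isCont_tendsto_compose[OF G(1) ray_tendsto] G(2) by simp
  then have "((\<lambda>t. gradient_vector (G (p + t *\<^sub>R v))) \<longlongrightarrow> gradient_vector 0) (at_right 0)"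
    unfolding gradient_vector_def by (intro tendsto_intros)
  then show "((\<lambda>t. gradient_vector (G (p + t *\<^sub>R v))) \<longlongrightarrow> 0) (at_right 0)"
    by (simp add: gradient_vector_def)
  show "\<forall>\<^sub>F t in at_right 0. gradient_vector (G (p + t *\<^sub>R v))
      \<in> limiting_subdifferential h (p + t *\<^sub>R v)"
    using h
    by eventually_elim
      (simp add: gradient_regular_subgradient regular_subgradient_limiting gradient_vector_inner)
qed

section \<open>Submanifolds containing an open cone of rays\<close>

text \<open>In straightened coordinates the derivative of the chart at \<open>p\<close> sends each \<open>u \<in> D\<close> into the model
  subspace \<open>L\<close>, hence it sends the whole space there. A chart has an invertible derivative, so \<open>L\<close>
  is the whole space and the chart domain is contained in \<open>N\<close>.\<close>

lemma submanifold_with_open_tangent_cone: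
  fixes N :: "'a::euclidean_space set"
  assumes N: "C2_embedded_submanifold N" "p \<in> N"
    and D: "open D" "v \<in> D"
    and rays: "\<And>u. u \<in> D \<Longrightarrow> \<forall>\<^sub>F t in at_right 0. p + t *\<^sub>R u \<in> N"
  shows "p \<in> interior N"
proof -
  obtain U \<phi> \<psi> and L :: "'a set" where U: "p \<in> U" and C: "C2_on U \<phi>" "C2_on (\<phi> ` U) \<psi>"
    and inv: "\<And>x. x \<in> U \<Longrightarrow> \<psi> (\<phi> x) = x"
    and L: "subspace L" and img: "\<phi> ` (N \<inter> U) = \<phi> ` U \<inter> L"
    using N unfolding C2_embedded_submanifold_def by metis
  have "open U" using C(1) by (simp add: C2_on_def)
  obtain \<phi>' where \<phi>': "(\<phi> has_derivative \<phi>') (at p)"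
    using C(1) U unfolding C2_on_def by blast
  obtain \<psi>' where \<psi>': "(\<psi> has_derivative \<psi>') (at (\<phi> p))"
    using C(2) U unfolding C2_on_def by blast
  \<comment> \<open>Differentiating \<open>\<psi> \<circ> \<phi> = id\<close> at \<open>p\<close> shows that \<open>\<phi>'\<close> is injective.\<close>
  have "((\<lambda>x. \<psi> (\<phi> x)) has_derivative (\<lambda>x. \<psi>' (\<phi>' x))) (at p)"
    using has_derivative_compose[OF \<phi>' \<psi>'] .
  moreover have "((\<lambda>x. \<psi> (\<phi> x)) has_derivative (\<lambda>x. x)) (at p)"
    by (rule has_derivative_transform_within_open[OF has_derivative_ident \<open>open U\<close> U])
      (simp add: inv)
  ultimately have "(\<lambda>x. \<psi>' (\<phi>' x)) = (\<lambda>x. x)"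
    by (rule has_derivative_unique)
  then have "inj \<phi>'"
    by (metis injI)
  have lin: "linear \<phi>'"
    using \<phi>' has_derivative_linear by blast
  have "\<phi>' u \<in> L" if "u \<in> D" for u
  proof (rule derivative_along_ray_in_subspace[OF \<phi>' L])
    show "\<phi> p \<in> L" using img U N(2) by blast
    show "\<forall>\<^sub>F t in at_right 0. \<phi> (p + t *\<^sub>R u) \<in> L"
      using rays[OF that] ray_eventually_in_open[OF \<open>open U\<close> U, of u]
      by eventually_elim (use img in blast)
  qed
  then have "range \<phi>' \<subseteq> L"
    using linear_image_of_open_in_subspace[OF lin L D] by blast
  moreover have "surj \<phi>'"
    using lin \<open>inj \<phi>'\<close> by (rule linear_injective_imp_surjective[OF _ _ refl])
  ultimately have "L = UNIV" by blast
  then have "\<phi> ` (N \<inter> U) = \<phi> ` U" using img by simp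
  then have "U \<subseteq> N"
    using inv by (smt (verit) IntD1 IntD2 imageE image_eqI subsetI)
  then show ?thesis
    using \<open>open U\<close> U by (meson interiorI)
qed

section \<open>Maxima of functions with distinct second-order models\<close>

text \<open>The normalization \<open>f p = 0\<close> is implicit in the limit, because \<open>f\<close> is continuous. The limit is the
  second-order Taylor expansion along rays; it is part of the notion because for sums of squares
  it follows from first-order expansions of the summands.\<close>

definition quadratic_model_at ::
    "('a::real_normed_vector \<Rightarrow> real) \<Rightarrow> 'a \<Rightarrow> ('a \<Rightarrow> 'a \<Rightarrow>\<^sub>L real) \<Rightarrow> ('a \<Rightarrow>\<^sub>L 'a \<Rightarrow>\<^sub>L real) \<Rightarrow> bool"
  where "quadratic_model_at f p G H \<longleftrightarrow>
    (\<forall>x. (f has_derivative G x) (at x)) \<and> (G has_derivative H) (at p) \<and> G p = 0 \<and>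
    (\<forall>v. ((\<lambda>t. f (p + t *\<^sub>R v) / t\<^sup>2) \<longlongrightarrow> 1/2 * H v v) (at_right 0))"

lemma dominating_piece_along_ray:
  fixes F :: "'i \<Rightarrow> 'a::real_normed_vector \<Rightarrow> real"
  assumes I: "finite I" "s \<in> I"
    and lim: "\<And>i. i \<in> I \<Longrightarrow> ((\<lambda>t. F i (p + t *\<^sub>R v) / t\<^sup>2) \<longlongrightarrow> q i) (at_right 0)"
    and dom: "\<And>j. j \<in> I \<Longrightarrow> j \<noteq> s \<Longrightarrow> q j < q s"
  shows "\<forall>\<^sub>F t in at_right 0. \<forall>j\<in>I. j \<noteq> s \<longrightarrow> F j (p + t *\<^sub>R v) < F s (p + t *\<^sub>R v)"
proof (intro eventually_ball_finite[OF I(1)] ballI)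
  fix j assume j: "j \<in> I"
  show "\<forall>\<^sub>F t in at_right 0. j \<noteq> s \<longrightarrow> F j (p + t *\<^sub>R v) < F s (p + t *\<^sub>R v)"
  proof (cases "j = s")
    case False
    have "((\<lambda>t. F s (p + t *\<^sub>R v) / t\<^sup>2 - F j (p + t *\<^sub>R v) / t\<^sup>2) \<longlongrightarrow> q s - q j) (at_right 0)"
      using lim j I(2) by (intro tendsto_diff) auto
    then have "\<forall>\<^sub>F t in at_right 0. 0 < F s (p + t *\<^sub>R v) / t\<^sup>2 - F j (p + t *\<^sub>R v) / t\<^sup>2"
      using dom[OF j False] by (intro order_tendstoD(1)) auto
    then show ?thesis
      using eventually_at_right_less[of 0]
      by eventually_elim (simp add: divide_less_cancel)
  qed simp
qed

text \<open>A strict inequality between continuous functions persists nearby, so the maximum coincides with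
  its dominating piece on a neighbourhood.\<close>

lemma Max_derivative_at_dominating_piece:
  fixes F :: "'i \<Rightarrow> 'a::real_normed_vector \<Rightarrow> real"
  assumes I: "finite I" "s \<in> I"
    and cont: "\<And>i. i \<in> I \<Longrightarrow> continuous_on UNIV (F i)"
    and deriv: "(F s has_derivative f') (at x)"
    and dom: "\<And>j. j \<in> I \<Longrightarrow> j \<noteq> s \<Longrightarrow> F j x < F s x"
  shows "((\<lambda>x. MAX i\<in>I. F i x) has_derivative f') (at x)"
proof (rule has_derivative_transform_within_open[OF deriv])
  let ?U = "\<Inter>j\<in>I - {s}. {y. F j y < F s y}"
  show "open ?U"
    using I cont by (intro open_INT ballI open_Collect_less) auto
  show "x \<in> ?U" using dom by simp
  show "F s y = (MAX i\<in>I. F i y)" if "y \<in> ?U" for y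
  proof (rule Max_eqI[symmetric])
    fix r assume "r \<in> (\<lambda>i. F i y) ` I"
    then obtain i where i: "i \<in> I" "r = F i y" by blast
    show "r \<le> F s y" using that i by (cases "i = s") (auto intro: less_imp_le)
  qed (use I in auto)
qed

text \<open>An identifiable manifold would be a neighbourhood of \<open>p\<close>, and the maximum would have there a
  second derivative that equals both \<open>H s1\<close> and \<open>H s2\<close>, each by comparison on the open cone that
  the piece dominates. The directions \<open>v1\<close> and \<open>v2\<close> witness that these cones are nonempty.\<close>

lemma no_C2_identifiable_manifold_of_two_dominating_pieces:
  fixes F :: "'i \<Rightarrow> 'a::euclidean_space \<Rightarrow> real"
    and G :: "'i \<Rightarrow> 'a \<Rightarrow> 'a \<Rightarrow>\<^sub>L real" and H :: "'i \<Rightarrow> 'a \<Rightarrow>\<^sub>L 'a \<Rightarrow>\<^sub>L real"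
  assumes I: "finite I"
    and models: "\<And>i. i \<in> I \<Longrightarrow> quadratic_model_at (F i) p (G i) (H i)"
    and s: "s1 \<in> I" "s2 \<in> I" "s1 \<noteq> s2"
    and dom1: "\<And>j. j \<in> I \<Longrightarrow> j \<noteq> s1 \<Longrightarrow> H j v1 v1 < H s1 v1 v1"
    and dom2: "\<And>j. j \<in> I \<Longrightarrow> j \<noteq> s2 \<Longrightarrow> H j v2 v2 < H s2 v2 v2"
  shows "\<not> C2_identifiable_manifold (\<lambda>x. MAX i\<in>I. F i x) p 0 M"
proof
  have F: "(F i has_derivative G i x) (at x)" and G: "(G i has_derivative H i) (at p)"
    and crit: "G i p = 0"
    and model: "((\<lambda>t. F i (p + t *\<^sub>R v) / t\<^sup>2) \<longlongrightarrow> 1/2 * H i v v) (at_right 0)"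
    if "i \<in> I" for i x v
    using models[OF that] by (auto simp: quadratic_model_at_def)
  let ?h = "\<lambda>x. MAX i\<in>I. F i x"
  define D where "D s = (\<Inter>j\<in>I - {s}. {v. H j v v < H s v v})" for s
  have D_open: "open (D s)" for s
    unfolding D_def using I
    by (intro open_INT ballI open_Collect_less continuous_intros) auto
  have vD: "v1 \<in> D s1" "v2 \<in> D s2"
    using dom1 dom2 by (auto simp: D_def)
  have piece: "\<forall>\<^sub>F t in at_right 0. (?h has_derivative G s (p + t *\<^sub>R v)) (at (p + t *\<^sub>R v))"
    if "s \<in> I" "v \<in> D s" for s v
  proof -
    have "\<forall>\<^sub>F t in at_right 0. \<forall>j\<in>I. j \<noteq> s \<longrightarrow> F j (p + t *\<^sub>R v) < F s (p + t *\<^sub>R v)"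
      using that(2) by (intro dominating_piece_along_ray[OF I that(1) model]) (auto simp: D_def)
    then show ?thesis
    proof eventually_elim
      case (elim t)
      show ?case
      proof (rule Max_derivative_at_dominating_piece[where s = s, OF I that(1)])
        show "continuous_on UNIV (F i)" if "i \<in> I" for i
          using F[OF that] by (meson has_derivative_continuous_on has_derivative_at_withinI)
      qed (use elim F that in auto)
    qed
  qed
  assume "C2_identifiable_manifold ?h p 0 M"
  then obtain U where M: "identifiable ?h p 0 M" and U: "open U" "p \<in> U"
    and N: "C2_embedded_submanifold (M \<inter> U)" "restricts_C2 (M \<inter> U) ?h"
    unfolding C2_identifiable_manifold_def by blast
  have pN: "p \<in> M \<inter> U"
    using M U by (simp add: identifiable_def)
  have "p \<in> interior (M \<inter> U)"
  proof (rule submanifold_with_open_tangent_cone[OF N(1) pN D_open vD(1)])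
    fix u assume u: "u \<in> D s1"
    have "\<forall>\<^sub>F t in at_right 0. p + t *\<^sub>R u \<in> M"
      using identifiable_captures_ray_of_smooth_piece[OF M _ crit[OF s(1)] piece[OF s(1) u]]
        has_derivative_continuous[OF G[OF s(1)]] by blast
    with ray_eventually_in_open[OF U, of u]
    show "\<forall>\<^sub>F t in at_right 0. p + t *\<^sub>R u \<in> M \<inter> U"
      by eventually_elim simp
  qed
  moreover obtain U' g where U': "p \<in> U'" "C2_on U' g"
    and gU': "\<And>x. x \<in> M \<inter> U \<inter> U' \<Longrightarrow> g x = ?h x"
    using N(2) pN unfolding restricts_C2_def by meson
  moreover define Z where "Z = interior (M \<inter> U) \<inter> U'"
  ultimately have Z: "open Z" "p \<in> Z"
    by (auto simp: C2_on_def)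
  have gh: "g x = ?h x" if "x \<in> Z" for x
    using that interior_subset by (intro gU') (auto simp: Z_def)
  obtain g' g'' where g': "\<And>x. x \<in> Z \<Longrightarrow> (g has_derivative blinfun_apply (g' x)) (at x)"
    and g'': "(g' has_derivative blinfun_apply g'') (at p)"
    using U'(1,2) unfolding C2_on_def Z_def by blast
  have agree: "H s w = g'' w" if s: "s \<in> I" and D: "v \<in> D s" for s v w
  proof -
    have "H s u - g'' u \<in> {0}" if "u \<in> D s" for u
    proof -
      have "\<forall>\<^sub>F t in at_right 0. G s (p + t *\<^sub>R u) = g' (p + t *\<^sub>R u)"
        using piece[OF s that] ray_eventually_in_open[OF Z, of u]
      proof eventually_elim
        case (elim t)
        have "(g has_derivative G s (p + t *\<^sub>R u)) (at (p + t *\<^sub>R u))"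
          by (rule has_derivative_transform_within_open[OF elim(1) Z(1) elim(2)]) (simp add: gh)
        from has_derivative_unique[OF this g'[OF elim(2)]] show ?case
          by (simp add: blinfun_apply_inject)
      qed
      then show ?thesis
        using derivatives_agree_along_ray[OF G[OF s] g''] by simp
    qed
    moreover have "linear (\<lambda>u. H s u - g'' u)"
      by (intro linear_compose_sub bounded_linear.linear blinfun.bounded_linear_right)
    ultimately have "H s w - g'' w \<in> {0}"
      using linear_image_of_open_in_subspace[of "\<lambda>u. H s u - g'' u" "{0}" "D s" v w]
        D_open D subspace_0 by auto
    then show ?thesis by simp
  qed
  have "H s1 v1 = H s2 v1"
    using agree s vD by metis
  then show False
    using dom1[of s2] s by simp
qed

section \<open>Half sums of squares at a common zero\<close>

text \<open>The gradient is \<open>\<Sum>i. r\<^sub>i \<nabla>r\<^sub>i\<close>. Differentiating it at a common zero of the \<open>r\<^sub>i\<close> kills the terms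
  with second derivatives of the \<open>r\<^sub>i\<close> and leaves the Gauss-Newton form of the first derivatives.\<close>

lemma half_sum_squares_second_order_model:
  fixes r :: "nat \<Rightarrow> 'a::real_normed_vector \<Rightarrow> real"
  assumes C2: "\<And>i. i < k \<Longrightarrow> C2_on UNIV (r i)" and zero: "\<And>i. i < k \<Longrightarrow> r i p = 0"
  obtains G :: "'a \<Rightarrow> 'a \<Rightarrow>\<^sub>L real" and H :: "'a \<Rightarrow>\<^sub>L 'a \<Rightarrow>\<^sub>L real"
  where "quadratic_model_at (\<lambda>x. 1/2 * (\<Sum>i<k. (r i x)\<^sup>2)) p G H"
    and "\<And>v. H v v = (\<Sum>i<k. (frechet_derivative (r i) (at p) v)\<^sup>2)"
proof -
  have "\<exists>d e. \<forall>x. (r i has_derivative blinfun_apply (d x)) (at x)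
      \<and> (d has_derivative blinfun_apply (e x)) (at x)" if "i < k" for i
    using C2[OF that] unfolding C2_on_def by blast
  then obtain d :: "nat \<Rightarrow> 'a \<Rightarrow> 'a \<Rightarrow>\<^sub>L real" and e :: "nat \<Rightarrow> 'a \<Rightarrow> 'a \<Rightarrow>\<^sub>L 'a \<Rightarrow>\<^sub>L real"
    where d: "\<And>i x. i < k \<Longrightarrow> (r i has_derivative d i x) (at x)"
    and e: "\<And>i x. i < k \<Longrightarrow> (d i has_derivative e i x) (at x)"
    by metis
  define G where "G x = (\<Sum>i<k. r i x *\<^sub>R d i x)" for x
  define H where "H = (\<Sum>i<k. blinfun_scaleR_left (d i p) o\<^sub>L d i p)"
  have H: "H v = (\<Sum>i<k. d i p v *\<^sub>R d i p)" for v
    by (simp add: H_def blinfun.sum_left)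
  have Hvv: "H v v = (\<Sum>i<k. (d i p v)\<^sup>2)" for v
    by (simp add: H blinfun.sum_left blinfun.scaleR_left power2_eq_square)
  show thesis
  proof (rule that[of G H], unfold quadratic_model_at_def, intro conjI allI)
    fix x
    have "((\<lambda>x. 1/2 * (\<Sum>i<k. (r i x)\<^sup>2)) has_derivative
        (\<lambda>v. 1/2 * (\<Sum>i<k. 2 * (r i x * d i x v)))) (at x)"
      using d by (auto intro!: derivative_eq_intros simp: algebra_simps)
    moreover have "(\<lambda>v. 1/2 * (\<Sum>i<k. 2 * (r i x * d i x v))) = blinfun_apply (G x)"
      by (simp add: fun_eq_iff G_def blinfun.sum_left blinfun.scaleR_left flip: sum_distrib_left)
    ultimately show "((\<lambda>x. 1/2 * (\<Sum>i<k. (r i x)\<^sup>2)) has_derivative G x) (at x)"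
      by simp
  next
    have "(G has_derivative (\<lambda>v. \<Sum>i<k. r i p *\<^sub>R e i p v + d i p v *\<^sub>R d i p)) (at p)"
      unfolding G_def using d e by (intro derivative_intros) auto
    moreover have "(\<lambda>v. \<Sum>i<k. r i p *\<^sub>R e i p v + d i p v *\<^sub>R d i p) = blinfun_apply H"
      using zero by (simp add: fun_eq_iff H)
    ultimately show "(G has_derivative H) (at p)" by simp
  next
    show "G p = 0" using zero by (simp add: G_def)
  next
    fix v
    show "H v v = (\<Sum>i<k. (frechet_derivative (r i) (at p) v)\<^sup>2)"
      unfolding Hvv by (intro sum.cong) (simp_all flip: frechet_derivative_at[OF d])
  next
    fix v
    have "((\<lambda>t. 1/2 * (\<Sum>i<k. ((r i (p + t *\<^sub>R v) - r i p) /\<^sub>R t)\<^sup>2)) \<longlongrightarrow> 1/2 * H v v) (at_right 0)"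
      unfolding Hvv using d by (intro tendsto_intros ray_difference_quotient) auto
    moreover have "(\<Sum>i<k. ((r i (p + t *\<^sub>R v) - r i p) /\<^sub>R t)\<^sup>2)
        = (\<Sum>i<k. (r i (p + t *\<^sub>R v))\<^sup>2) / t\<^sup>2" for t
      unfolding sum_divide_distrib using zero
      by (intro sum.cong) (simp_all add: power2_eq_square divide_inverse)
    ultimately show "((\<lambda>t. 1/2 * (\<Sum>i<k. (r i (p + t *\<^sub>R v))\<^sup>2) / t\<^sup>2) \<longlongrightarrow> 1/2 * H v v) (at_right 0)"
      by (simp add: mult.commute)
  qed
qed

section \<open>Inactivity of common interpolators\<close>

theorem theorem4p1:
  fixes Dfn :: "nat \<Rightarrow> real list set set"
    and S :: nat and m :: "nat \<Rightarrow> nat"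
    and R :: "nat \<Rightarrow> real ^ 'd \<Rightarrow> nat \<Rightarrow> real"
    and xbar :: "real ^ 'd"
    and W :: "(real ^ 'd) set" and s1 s2 :: nat
  assumes "o_minimal_structure Dfn"
    and "S \<ge> 1"
    and "\<And>s. s \<in> {1..S} \<Longrightarrow> C2_map (m s) (R s)"
    and "\<And>s. s \<in> {1..S} \<Longrightarrow> definable_map Dfn (m s) (R s)"
    and "\<And>s i. s \<in> {1..S} \<Longrightarrow> i < m s \<Longrightarrow> R s xbar i = 0"
    and "subspace W"
    and "s1 \<in> {1..S}" and "s2 \<in> {1..S}" and "s1 \<noteq> s2"
    and "dominance_set S m R xbar W s1 \<noteq> {}"
    and "dominance_set S m R xbar W s2 \<noteq> {}"
  shows "inactive (f_GDRO S m R) xbar \<and> (\<forall>x. f_GDRO S m R xbar \<le> f_GDRO S m R x)"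
proof -
  define F where "F s x = 1/2 * (\<Sum>i<m s. (R s x i)\<^sup>2)" for s x
  have f: "f_GDRO S m R = (\<lambda>x. MAX s\<in>{1..S}. F s x)"
    by (simp add: fun_eq_iff f_GDRO_def F_def)
  have "f_GDRO S m R x \<ge> 0" for x
  proof -
    have "0 \<le> F 1 x" by (simp add: F_def sum_nonneg)
    also have "\<dots> \<le> f_GDRO S m R x"
      unfolding f using \<open>S \<ge> 1\<close> by (intro Max_ge) auto
    finally show ?thesis .
  qed
  moreover have "f_GDRO S m R xbar = 0"
    unfolding f using assms(2,5) by (intro Max_eqI) (auto simp: F_def image_iff intro!: bexI[of _ 1])
  ultimately have min: "f_GDRO S m R xbar \<le> f_GDRO S m R x" for x
    by simp
  have "\<exists>G H. quadratic_model_at (F s) xbar G H \<and> (\<forall>v. 1/2 * H v v = q_form m R xbar s v)"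
    if s: "s \<in> {1..S}" for s
  proof -
    have "C2_on UNIV (\<lambda>x. R s x i)" "R s xbar i = 0" if "i < m s" for i
      using assms(3,5)[OF s] that by (auto simp: C2_map_def)
    from half_sum_squares_second_order_model[of "m s" "\<lambda>i x. R s x i", OF this]
    show ?thesis unfolding F_def q_form_def by metis
  qed
  then obtain G H where model: "\<And>s. s \<in> {1..S} \<Longrightarrow> quadratic_model_at (F s) xbar (G s) (H s)"
    and q: "\<And>s v. s \<in> {1..S} \<Longrightarrow> 1/2 * H s v v = q_form m R xbar s v"
    by metis
  have dominant: "\<exists>v. \<forall>j\<in>{1..S}. j \<noteq> s \<longrightarrow> H j v v < H s v v"
    if s: "s \<in> {1..S}" and nonempty: "dominance_set S m R xbar W s \<noteq> {}" for s
  proof -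
    obtain v where v: "\<And>j. j \<in> {1..S} \<Longrightarrow> j \<noteq> s \<Longrightarrow> q_form m R xbar j v < q_form m R xbar s v"
      using nonempty unfolding dominance_set_def by blast
    have "H j v v < H s v v" if "j \<in> {1..S}" "j \<noteq> s" for j
      using v[OF that] q[OF s, of v] q[OF that(1), of v] by linarith
    then show ?thesis by blast
  qed
  obtain v1 v2 where "\<And>j. j \<in> {1..S} \<Longrightarrow> j \<noteq> s1 \<Longrightarrow> H j v1 v1 < H s1 v1 v1"
    and "\<And>j. j \<in> {1..S} \<Longrightarrow> j \<noteq> s2 \<Longrightarrow> H j v2 v2 < H s2 v2 v2"
    using dominant[OF assms(7,10)] dominant[OF assms(8,11)] by blast
  then have "\<not> C2_identifiable_manifold (f_GDRO S m R) xbar 0 M" for M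
    unfolding f
    by (intro no_C2_identifiable_manifold_of_two_dominating_pieces
        [OF finite_atLeastAtMost model assms(7-9)])
  then show ?thesis
    using min zero_limiting_subgradient_of_global_minimizer[of "f_GDRO S m R" xbar]
    by (auto simp: inactive_def)
qed

end
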